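(* Let $p$ and $q$ be distinct primes, let $G$ be a cyclic group of order $p^2q^2$ with identity $e_G$, let $S_1=\{x\in G: |x|=p \text{ or } |x|=q\}$, $S_2=\{x\in G: |x|=p^2 \text{ or } |x|=q^2\}$, $S_3=\{e_G\}$. Then the independence number of the Bi-Cayley graph $\Gamma=\mathrm{BiCay}(G;S_1,S_2,S_3)$ is $2pq\min\{p,q\}-\min\{p^2,q^2\}$.
   Context: $|x|$ denotes the order of the element $x$. For a group $G$ and nonempty subsets $S_1,S_2,S_3\subseteq G$ with $S_1,S_2,S_3$ inverse-closed and $e_G\notin S_1\cup S_2$, the Bi-Cayley graph $\mathrm{BiCay}(G;S_1,S_2,S_3)$ is the simple graph with vertex set $\{0,1\}\times G$ in which two distinct vertices $(i,x),(j,y)$ are adjacent iff: $xy^{-1}\in S_1$ when $i=j=0$; $xy^{-1}\in S_2$ when $i=j=1$; $xy^{-1}\in S_3$ when $i\ne j$. The independence number is the maximum size of a set of pairwise non-adjacent vertices. *)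

theory Defs
  imports
    "Graph_Theory.Pair_Digraph"
    "HOL-Algebra.Elementary_Groups"
    "HOL-Number_Theory.Residues"
begin

text \<open>
  A simple graph is represented, as usual for \<^theory>\<open>Graph_Theory.Pair_Digraph\<close>, by a symmetric
  loop-free digraph (\<^locale>\<open>pair_graph\<close>): an edge \<open>{u, v}\<close> is the pair of arcs \<open>(u, v)\<close>, \<open>(v, u)\<close>.
  The lemma \<open>pair_graph_bicay\<close> below confirms this for Bi-Cayley graphs; the definition itself does
  not enforce that the connection sets are inverse-closed.
\<close>

definition bicay ::
  "('a, 'b) monoid_scheme \<Rightarrow> 'a set \<Rightarrow> 'a set \<Rightarrow> 'a set \<Rightarrow> (nat \<times> 'a) pair_pre_digraph"
  where
  "bicay G S\<^sub>1 S\<^sub>2 S\<^sub>3 =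
    \<lparr> pverts = {0, 1} \<times> carrier G,
      parcs = {((i, x), (j, y)) | i x j y.
        (i, x) \<in> {0, 1} \<times> carrier G \<and> (j, y) \<in> {0, 1} \<times> carrier G \<and> (i, x) \<noteq> (j, y) \<and>
        (i = 0 \<and> j = 0 \<longrightarrow> x \<otimes>\<^bsub>G\<^esub> inv\<^bsub>G\<^esub> y \<in> S\<^sub>1) \<and>
        (i = 1 \<and> j = 1 \<longrightarrow> x \<otimes>\<^bsub>G\<^esub> inv\<^bsub>G\<^esub> y \<in> S\<^sub>2) \<and>
        (i \<noteq> j \<longrightarrow> x \<otimes>\<^bsub>G\<^esub> inv\<^bsub>G\<^esub> y \<in> S\<^sub>3)} \<rparr>"

lemma (in group) pair_graph_bicay:
  assumes "finite (carrier G)"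
    and inv_closed: "\<And>x. x \<in> S\<^sub>1 \<Longrightarrow> inv x \<in> S\<^sub>1" "\<And>x. x \<in> S\<^sub>2 \<Longrightarrow> inv x \<in> S\<^sub>2"
      "\<And>x. x \<in> S\<^sub>3 \<Longrightarrow> inv x \<in> S\<^sub>3"
  shows "pair_graph (bicay G S\<^sub>1 S\<^sub>2 S\<^sub>3)"
proof -
  have flip: "y \<otimes> inv x \<in> S"
    if "x \<in> carrier G" "y \<in> carrier G" "x \<otimes> inv y \<in> S" "\<And>z. z \<in> S \<Longrightarrow> inv z \<in> S" for x y S
    using that(4)[OF that(3)] that(1,2) by (simp add: inv_mult_group)
  note flips = flip[where S = S\<^sub>1, OF _ _ _ inv_closed(1)] flip[where S = S\<^sub>2, OF _ _ _ inv_closed(2)]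
    flip[where S = S\<^sub>3, OF _ _ _ inv_closed(3)]
  have "parcs (bicay G S\<^sub>1 S\<^sub>2 S\<^sub>3) \<subseteq>
      ({0, 1} \<times> carrier G) \<times> ({0, 1} \<times> carrier G)"
    by (auto simp: bicay_def)
  then have "finite (parcs (bicay G S\<^sub>1 S\<^sub>2 S\<^sub>3))"
    using assms(1) by (auto intro: finite_subset)
  moreover have "sym (parcs (bicay G S\<^sub>1 S\<^sub>2 S\<^sub>3))"
    by (rule symI) (auto simp: bicay_def intro: flips)
  ultimately show ?thesis
    using assms(1) by unfold_locales (auto simp: bicay_def symmetric_def)
qed

definition independent_set :: "('a, 'b) pre_digraph \<Rightarrow> 'a set \<Rightarrow> bool" where
  "independent_set \<Gamma> A \<longleftrightarrow>
    A \<subseteq> verts \<Gamma> \<and> (\<forall>u\<in>A. \<forall>v\<in>A. u \<noteq> v \<longrightarrow> \<not> u \<rightarrow>\<^bsub>\<Gamma>\<^esub> v)"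

text \<open>Only meaningful for graphs with finitely many vertices, since \<^const>\<open>Max\<close> is.\<close>

definition independence_number :: "('a, 'b) pre_digraph \<Rightarrow> nat" where
  "independence_number \<Gamma> = Max {card A | A. independent_set \<Gamma> A}"

end

theory Submission
  imports Defs
begin

text \<open>
  Write \<open>G\<close> as the grid \<open>\<int>/p\<^sup>2 \<times> \<int>/q\<^sup>2\<close>. Every edge inside a layer joins two points of the same row or
  of the same column: in layer 0 they differ by a nonzero multiple of \<open>p\<close> (or \<open>q\<close>), in layer 1 by
  a non-multiple. Split a row of length \<open>q\<^sup>2\<close> into its \<open>q\<close> residue classes modulo \<open>q\<close>. An independent
  set meets each class at most once in layer 0 and meets a single class in layer 1; as the two layers
  must be disjoint, it has at most \<open>q\<close> points over that class and one over each other class, hence at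
  most \<open>2q - 1\<close> points over the row. So the independence number is at most \<open>p\<^sup>2(2q - 1)\<close>. For
  \<open>p < q\<close> this is attained by taking \<open>(a, b)\<close> in layer 1 iff \<open>a mod p = b mod q\<close>, and in layer 0 iff
  \<open>a mod p \<noteq> b mod q\<close> and \<open>a div p = b div q\<close>.
\<close>

section \<open>Element orders as conditions on powers\<close>

lemma (in group) ord_eq_prime_iff:
  assumes "prime p" "x \<in> carrier G"
  shows "ord x = p \<longleftrightarrow> x [^] p = \<one> \<and> x \<noteq> \<one>"
proof -
  have "ord x = p \<longleftrightarrow> ord x dvd p \<and> ord x \<noteq> 1"
    using assms(1) by (auto simp: prime_nat_iff)
  then show ?thesis
    using assms(2) by (simp only: pow_eq_id ord_eq_1)
qed

text \<open>The first equation forces the order to be \<open>p ^ i\<close> with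
  \<open>i \<le> 2\<close>, and the second condition excludes \<open>i \<le> 1\<close>. Together
  with \<open>ord_eq_prime_iff\<close> this turns membership in the connection sets into power
  equations, which can be evaluated in coordinates.\<close>

lemma (in group) ord_eq_prime_sq_iff:
  assumes "prime p" "x \<in> carrier G"
  shows "ord x = p\<^sup>2 \<longleftrightarrow> x [^] (p\<^sup>2) = \<one> \<and> x [^] p \<noteq> \<one>"
proof
  assume "ord x = p\<^sup>2"
  moreover have "\<not> p\<^sup>2 dvd p"
    using assms(1) by (auto simp: power2_eq_square dest: prime_gt_1_nat)
  ultimately show "x [^] (p\<^sup>2) = \<one> \<and> x [^] p \<noteq> \<one>"
    using assms(2) by (simp add: pow_eq_id)
next
  assume *: "x [^] (p\<^sup>2) = \<one> \<and> x [^] p \<noteq> \<one>"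
  then obtain i where i: "i \<le> 2" "ord x = p ^ i"
    using assms by (auto simp: pow_eq_id divides_primepow_nat)
  moreover have "\<not> i \<le> 1"
    using * i(2) assms(2) le_imp_power_dvd[of i 1 p] by (auto simp: pow_eq_id)
  ultimately have "i = 2"
    by linarith
  with i(2) show "ord x = p\<^sup>2"
    by simp
qed

section \<open>Grid coordinates by the Chinese remainder theorem\<close>

text \<open>Modulo \<open>m\<close> the term \<open>y * m\<close> vanishes and \<open>n\<close> is
  invertible; modulo \<open>n\<close> the roles are exchanged.\<close>

lemma dvd_add_cross_iff:
  fixes m n x y :: int
  assumes "coprime m n"
  shows "m * n dvd x * n + y * m \<longleftrightarrow> m dvd x \<and> n dvd y"
proof -
  have "m * n dvd x * n + y * m \<longleftrightarrow> m dvd x * n + y * m \<and> n dvd x * n + y * m"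
    using assms by (auto intro: divides_mult dest: dvd_mult_left dvd_mult_right)
  also have "\<dots> \<longleftrightarrow> m dvd x \<and> n dvd y"
    using assms coprime_commute[of m n]
    by (simp add: dvd_add_left_iff dvd_add_right_iff coprime_dvd_mult_left_iff)
  finally show ?thesis .
qed

text \<open>For a generator \<open>g\<close>, the point \<open>(a, b)\<close> is sent to
  \<open>g\<close> to the power \<open>a * n + b * m\<close>. The free exponent \<open>r\<close>
  handles equality of points (\<open>r = 1\<close>) and all order tests (\<open>r\<close> one of
  \<open>p\<close>, \<open>q\<close> and their squares) at once.\<close>

lemma (in group) cyclic_group_coordinates:
  assumes "cyclic_group G" "order G = m * n" "coprime m n" "0 < m" "0 < n"
  obtains \<phi> :: "nat \<times> nat \<Rightarrow> 'a"
  where "bij_betw \<phi> ({..<m} \<times> {..<n}) (carrier G)"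
    and "\<And>a b a' b' r. (\<phi> (a, b) \<otimes> inv \<phi> (a', b')) [^] r = \<one> \<longleftrightarrow>
      [r * a = r * a'] (mod m) \<and> [r * b = r * b'] (mod n)"
proof -
  have "finite (carrier G)"
    using assms by (metis order_gt_0_iff_finite nat_0_less_mult_iff)
  obtain g where g: "g \<in> carrier G" "subgroup_generated G {g} = G"
    using assms(1) by (auto simp: cyclic_group_def)
  then have "generate G {g} = carrier G"
    using carrier_subgroup_generated[of G "{g}"] by simp
  then have ord: "ord g = m * n"
    using g(1) assms(2) by (simp add: generate_pow_card order_def)
  \<comment> \<open>The exponent is an integer so that a quotient of two points is again a power of
    \<open>g\<close>, with the difference as exponent.\<close>
  define \<phi> where "\<phi> = (\<lambda>(a, b). g [^] (int a * int n + int b * int m))"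
  have closed: "\<phi> z \<in> carrier G" for z
    using g(1) by (simp add: \<phi>_def split: prod.split)
  have pow: "(\<phi> (a, b) \<otimes> inv \<phi> (a', b')) [^] r = \<one> \<longleftrightarrow>
      [r * a = r * a'] (mod m) \<and> [r * b = r * b'] (mod n)" for a b a' b' r :: nat
  proof -
    let ?x = "int r * (int a - int a')" and ?y = "int r * (int b - int b')"
    have "(\<phi> (a, b) \<otimes> inv \<phi> (a', b')) [^] r =
      g [^] ((int a * int n + int b * int m - (int a' * int n + int b' * int m)) * int r)"
      using g(1) by (simp add: \<phi>_def int_pow_diff[symmetric] int_pow_pow int_pow_int[symmetric])
    also have "(int a * int n + int b * int m - (int a' * int n + int b' * int m)) * int r =
      ?x * int n + ?y * int m"
      by (simp add: algebra_simps)
    also have "g [^] (?x * int n + ?y * int m) = \<one> \<longleftrightarrow> int m dvd ?x \<and> int n dvd ?y"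
      using g(1) ord assms(3) by (simp add: int_pow_eq_id dvd_add_cross_iff)
    also have "\<dots> \<longleftrightarrow> [r * a = r * a'] (mod m) \<and> [r * b = r * b'] (mod n)"
      by (simp add: cong_int_iff[symmetric] cong_iff_dvd_diff right_diff_distrib)
    finally show ?thesis .
  qed
  have "inj_on \<phi> ({..<m} \<times> {..<n})"
  proof (rule inj_onI)
    fix z z'
    assume "z \<in> {..<m} \<times> {..<n}" "z' \<in> {..<m} \<times> {..<n}" "\<phi> z = \<phi> z'"
    then show "z = z'"
      using pow[of "fst z" "snd z" "fst z'" "snd z'" 1] closed
      by (auto intro: cong_less_modulus_unique_nat)
  qed
  moreover have "\<phi> ` ({..<m} \<times> {..<n}) \<subseteq> carrier G"
    using closed by blast
  ultimately have "bij_betw \<phi> ({..<m} \<times> {..<n}) (carrier G)"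
    using \<open>finite (carrier G)\<close> assms(2)
    by (simp add: bij_betw_def order_def card_image card_subset_eq)
  then show thesis
    using pow that by blast
qed

text \<open>For example, the quotient of two points has order \<open>p\<^sup>2\<close> iff its power
  \<open>p\<^sup>2\<close> is trivial, which means \<open>b = b'\<close>, and its power
  \<open>p\<close> is not, which then means \<open>a mod p \<noteq> a' mod p\<close>.\<close>

lemma (in group) bicay_coordinates:
  assumes "prime p" "prime q" "p \<noteq> q" "cyclic_group G" "order G = p\<^sup>2 * q\<^sup>2"
  obtains \<phi> :: "nat \<times> nat \<Rightarrow> 'a"
  where "bij_betw \<phi> ({..<p\<^sup>2} \<times> {..<q\<^sup>2}) (carrier G)"
    and "\<And>i j a b a' b'. \<lbrakk>i \<in> {0, 1}; j \<in> {0, 1}; a < p\<^sup>2; b < q\<^sup>2; a' < p\<^sup>2; b' < q\<^sup>2\<rbrakk> \<Longrightarrow>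
      ((i, \<phi> (a, b)), (j, \<phi> (a', b'))) \<in> parcs (bicay G
        {x \<in> carrier G. ord x = p \<or> ord x = q} {x \<in> carrier G. ord x = p\<^sup>2 \<or> ord x = q\<^sup>2} {\<one>}) \<longleftrightarrow>
      i = 0 \<and> j = 0 \<and>
        (b = b' \<and> a \<noteq> a' \<and> a mod p = a' mod p \<or> a = a' \<and> b \<noteq> b' \<and> b mod q = b' mod q) \<or>
      i = 1 \<and> j = 1 \<and>
        (b = b' \<and> a mod p \<noteq> a' mod p \<or> a = a' \<and> b mod q \<noteq> b' mod q) \<or>
      i \<noteq> j \<and> a = a' \<and> b = b'"
proof -
  have cop: "coprime (p\<^sup>2) (q\<^sup>2)" and pq: "coprime p (q\<^sup>2)" "coprime q (p\<^sup>2)"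
    using assms(1-3) by (auto simp: primes_coprime)
  have pos: "0 < p" "0 < q"
    using assms(1,2) by (auto simp: prime_gt_0_nat)
  obtain \<phi> where \<phi>: "bij_betw \<phi> ({..<p\<^sup>2} \<times> {..<q\<^sup>2}) (carrier G)"
    and pow: "\<And>a b a' b' r. (\<phi> (a, b) \<otimes> inv \<phi> (a', b')) [^] r = \<one> \<longleftrightarrow>
      [r * a = r * a'] (mod p\<^sup>2) \<and> [r * b = r * b'] (mod q\<^sup>2)"
    using cyclic_group_coordinates[OF assms(4,5) cop] pos by auto
  \<comment> \<open>The three ways in which an exponent meets a modulus: its own square, which
    leaves a congruence modulo \<open>r\<close>; equal to it, which leaves no condition; coprime to
    it, which leaves equality of reduced representatives.\<close>
  have self: "[r * x = r * y] (mod r\<^sup>2) \<longleftrightarrow> x mod r = y mod r" if "0 < r" for r x y :: nat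
    using that by (simp add: power2_eq_square cong_def mult_mod_right[symmetric])
  have full: "[r\<^sup>2 * x = r\<^sup>2 * y] (mod r\<^sup>2)" for r x y :: nat
    by (simp add: cong_def)
  have other: "[r * x = r * y] (mod s) \<longleftrightarrow> x = y" if "coprime r s" "x < s" "y < s" for r s x y :: nat
    using that by (auto simp: cong_mult_lcancel_nat cong_less_modulus_unique_nat)
  have z1: "\<phi> (a, b) \<otimes> inv \<phi> (a', b') = \<one> \<longleftrightarrow> a = a' \<and> b = b'"
    and zp: "(\<phi> (a, b) \<otimes> inv \<phi> (a', b')) [^] p = \<one> \<longleftrightarrow> a mod p = a' mod p \<and> b = b'"
    and zq: "(\<phi> (a, b) \<otimes> inv \<phi> (a', b')) [^] q = \<one> \<longleftrightarrow> a = a' \<and> b mod q = b' mod q"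
    and zp2: "(\<phi> (a, b) \<otimes> inv \<phi> (a', b')) [^] (p\<^sup>2) = \<one> \<longleftrightarrow> b = b'"
    and zq2: "(\<phi> (a, b) \<otimes> inv \<phi> (a', b')) [^] (q\<^sup>2) = \<one> \<longleftrightarrow> a = a'"
    and z: "\<phi> (a, b) \<otimes> inv \<phi> (a', b') \<in> carrier G"
    if "a < p\<^sup>2" "b < q\<^sup>2" "a' < p\<^sup>2" "b' < q\<^sup>2" for a b a' b'
  proof -
    show z: "\<phi> (a, b) \<otimes> inv \<phi> (a', b') \<in> carrier G"
      using \<phi> that by (auto simp: bij_betw_def)
    show "\<phi> (a, b) \<otimes> inv \<phi> (a', b') = \<one> \<longleftrightarrow> a = a' \<and> b = b'"
      using pow[of a b a' b' 1] z that other[of 1] by simp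
  qed (use pow that full self pos other pq cop in \<open>simp_all add: coprime_commute\<close>)
  show thesis
  proof (rule that[OF \<phi>])
    fix i j :: nat and a b a' b'
    assume "i \<in> {0, 1}" "j \<in> {0, 1}" and lt: "a < p\<^sup>2" "b < q\<^sup>2" "a' < p\<^sup>2" "b' < q\<^sup>2"
    moreover have "\<phi> (a, b) \<in> carrier G" "\<phi> (a', b') \<in> carrier G"
      and "\<phi> (a, b) = \<phi> (a', b') \<longleftrightarrow> a = a' \<and> b = b'"
      using \<phi> lt by (auto simp: bij_betw_def inj_on_def)
    moreover note z[OF lt] z1[OF lt] zp[OF lt] zq[OF lt] zp2[OF lt] zq2[OF lt]
    ultimately show "((i, \<phi> (a, b)), (j, \<phi> (a', b'))) \<in> parcs (bicay G
        {x \<in> carrier G. ord x = p \<or> ord x = q} {x \<in> carrier G. ord x = p\<^sup>2 \<or> ord x = q\<^sup>2} {\<one>}) \<longleftrightarrow>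
      i = 0 \<and> j = 0 \<and>
        (b = b' \<and> a \<noteq> a' \<and> a mod p = a' mod p \<or> a = a' \<and> b \<noteq> b' \<and> b mod q = b' mod q) \<or>
      i = 1 \<and> j = 1 \<and>
        (b = b' \<and> a mod p \<noteq> a' mod p \<or> a = a' \<and> b mod q \<noteq> b' mod q) \<or>
      i \<noteq> j \<and> a = a' \<and> b = b'"
      using assms(1,2) by (auto simp: bicay_def ord_eq_prime_iff ord_eq_prime_sq_iff)
  qed
qed

section \<open>Counting in a single row\<close>

lemma card_residue_class:
  fixes d q :: nat
  assumes "d < q"
  shows "card {b. b < q\<^sup>2 \<and> b mod q = d} = q"
proof -
  have "bij_betw (\<lambda>k. k * q + d) {..<q} {b. b < q\<^sup>2 \<and> b mod q = d}"
  proof (rule bij_betw_byWitness[where f' = "\<lambda>b. b div q"])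
    show "(\<lambda>k. k * q + d) ` {..<q} \<subseteq> {b. b < q\<^sup>2 \<and> b mod q = d}"
    proof clarsimp
      fix k assume k: "k < q"
      have "k * q + d < Suc k * q"
        using assms by simp
      also have "\<dots> \<le> q * q"
        using k by (intro mult_le_mono) auto
      finally show "k * q + d < q\<^sup>2 \<and> d mod q = d"
        using assms by (simp add: power2_eq_square)
    qed
  qed (use assms in \<open>auto simp: less_mult_imp_div_less power2_eq_square\<close>)
  from bij_betw_same_card[OF this] show ?thesis
    by simp
qed

text \<open>\<open>L\<^sub>0\<close> and \<open>L\<^sub>1\<close> are the two layers of an
  independent set over one row. By disjointness, all their points in the class \<open>d\<close> of
  \<open>L\<^sub>1\<close> share its \<open>q\<close> places; the rest of \<open>L\<^sub>0\<close>
  injects into the other \<open>q - 1\<close> residues.\<close>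

lemma row_bound:
  fixes L\<^sub>0 L\<^sub>1 :: "nat set"
  assumes sub: "L\<^sub>0 \<subseteq> {..<q\<^sup>2}" "L\<^sub>1 \<subseteq> {..<q\<^sup>2}" and disj: "L\<^sub>0 \<inter> L\<^sub>1 = {}" and "0 < q"
    and inj: "inj_on (\<lambda>b. b mod q) L\<^sub>0"
    and single: "\<And>b b'. \<lbrakk>b \<in> L\<^sub>1; b' \<in> L\<^sub>1\<rbrakk> \<Longrightarrow> b mod q = b' mod q"
  shows "card L\<^sub>0 + card L\<^sub>1 \<le> 2 * q - 1"
proof -
  \<comment> \<open>If \<open>L\<^sub>1\<close> is empty, any residue \<open>d\<close> will
    do.\<close>
  obtain d where d: "d < q" "\<And>b. b \<in> L\<^sub>1 \<Longrightarrow> b mod q = d"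
    using single \<open>0 < q\<close> by (metis mod_less_divisor)
  have fin: "finite L\<^sub>0" "finite L\<^sub>1"
    using sub finite_subset by blast+
  define M where "M = {b \<in> L\<^sub>0. b mod q = d}"
  have "card (M \<union> L\<^sub>1) \<le> card {b. b < q\<^sup>2 \<and> b mod q = d}"
    using sub d by (intro card_mono) (auto simp: M_def)
  then have on_class: "card M + card L\<^sub>1 \<le> q"
    using fin disj d(1) by (subst (asm) card_Un_disjoint) (auto simp: M_def card_residue_class)
  have "card (L\<^sub>0 - M) \<le> card ({..<q} - {d})"
    using inj \<open>0 < q\<close> by (intro card_inj_on_le[of "\<lambda>b. b mod q"]) (auto simp: M_def inj_on_def)
  then have "card (L\<^sub>0 - M) \<le> q - 1"
    using d(1) by simp
  moreover have "card L\<^sub>0 = card M + card (L\<^sub>0 - M)"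
    using fin by (metis M_def card_Un_disjoint Diff_disjoint Un_Diff_cancel Un_absorb1 finite_Diff
      finite_subset mem_Collect_eq subsetI)
  ultimately show ?thesis
    using on_class by linarith
qed

text \<open>Counts the extremal set over row \<open>a\<close>: layer 0 is a block of
  \<open>q\<close> consecutive numbers without its one element of residue \<open>a mod p\<close>,
  layer 1 is a full residue class.\<close>

lemma row_attained:
  fixes p q a :: nat
  assumes "p < q" "a < p\<^sup>2"
  shows "card {b. b < q\<^sup>2 \<and> b mod q \<noteq> a mod p \<and> b div q = a div p} = q - 1"
    and "card {b. b < q\<^sup>2 \<and> b mod q = a mod p} = q"
proof -
  have "0 < p"
    using assms(2) by (cases p) auto
  \<comment> \<open>This is where \<open>p < q\<close> enters: both base-\<open>p\<close> digits of
    \<open>a\<close> are also base-\<open>q\<close> digits.\<close>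
  then have lt: "a mod p < q" "a div p < q"
    using assms(1) less_mult_imp_div_less[of a p p] less_trans[OF mod_less_divisor[of p a]] assms(2)
    by (auto simp: power2_eq_square)
  then show "card {b. b < q\<^sup>2 \<and> b mod q = a mod p} = q"
    by (simp add: card_residue_class)
  have "bij_betw (\<lambda>r. a div p * q + r) ({..<q} - {a mod p})
      {b. b < q\<^sup>2 \<and> b mod q \<noteq> a mod p \<and> b div q = a div p}"
  proof (rule bij_betw_byWitness[where f' = "\<lambda>b. b mod q"])
    show "(\<lambda>r. a div p * q + r) ` ({..<q} - {a mod p}) \<subseteq>
      {b. b < q\<^sup>2 \<and> b mod q \<noteq> a mod p \<and> b div q = a div p}"
    proof clarsimp
      fix r assume r: "r < q"
      have "a div p * q + r < Suc (a div p) * q"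
        using r by simp
      also have "\<dots> \<le> q * q"
        using lt(2) by (intro mult_le_mono) auto
      finally show "a div p * q + r < q\<^sup>2"
        by (simp add: power2_eq_square)
    qed
  qed (use assms(1) in \<open>auto simp: div_mult_mod_eq\<close>, metis div_mult_mod_eq)
  from bij_betw_same_card[OF this]
  show "card {b. b < q\<^sup>2 \<and> b mod q \<noteq> a mod p \<and> b div q = a div p} = q - 1"
    using lt by simp
qed

section \<open>The independence number for \<open>p < q\<close>\<close>

lemma (in group) independence_number_bicay_less:
  assumes "prime p" "prime q" "p < q" "cyclic_group G" "order G = p\<^sup>2 * q\<^sup>2"
  shows "independence_number (with_proj (bicay G
      {x \<in> carrier G. ord x = p \<or> ord x = q} {x \<in> carrier G. ord x = p\<^sup>2 \<or> ord x = q\<^sup>2} {\<one>}))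
    = p\<^sup>2 * (2 * q - 1)" (is "independence_number (with_proj (bicay G ?S\<^sub>1 ?S\<^sub>2 _)) = _")
proof -
  let ?B = "with_proj (bicay G ?S\<^sub>1 ?S\<^sub>2 {\<one>})"
  have "0 < q" "p \<noteq> q"
    using assms(3) by simp_all
  obtain \<phi> where \<phi>: "bij_betw \<phi> ({..<p\<^sup>2} \<times> {..<q\<^sup>2}) (carrier G)"
    and coord: "\<And>i j a b a' b'. \<lbrakk>i \<in> {0, 1}; j \<in> {0, 1}; a < p\<^sup>2; b < q\<^sup>2; a' < p\<^sup>2; b' < q\<^sup>2\<rbrakk> \<Longrightarrow>
      ((i, \<phi> (a, b)), (j, \<phi> (a', b'))) \<in> parcs (bicay G
        {x \<in> carrier G. ord x = p \<or> ord x = q} {x \<in> carrier G. ord x = p\<^sup>2 \<or> ord x = q\<^sup>2} {\<one>}) \<longleftrightarrow>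
      i = 0 \<and> j = 0 \<and>
        (b = b' \<and> a \<noteq> a' \<and> a mod p = a' mod p \<or> a = a' \<and> b \<noteq> b' \<and> b mod q = b' mod q) \<or>
      i = 1 \<and> j = 1 \<and>
        (b = b' \<and> a mod p \<noteq> a' mod p \<or> a = a' \<and> b mod q \<noteq> b' mod q) \<or>
      i \<noteq> j \<and> a = a' \<and> b = b'"
    using that by (rule bicay_coordinates[OF assms(1,2) \<open>p \<noteq> q\<close> assms(4,5)])
  have closed: "\<phi> (a, b) \<in> carrier G" if "a < p\<^sup>2" "b < q\<^sup>2" for a b
    using \<phi> that by (auto simp: bij_betw_def)
  have inj: "\<phi> (a, b) = \<phi> (a', b') \<longleftrightarrow> a = a' \<and> b = b'"
    if "a < p\<^sup>2" "b < q\<^sup>2" "a' < p\<^sup>2" "b' < q\<^sup>2" for a b a' b'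
    using \<phi> that by (auto simp: bij_betw_def inj_on_def)
  have arc: "u \<rightarrow>\<^bsub>?B\<^esub> v \<longleftrightarrow> (u, v) \<in> parcs (bicay G ?S\<^sub>1 ?S\<^sub>2 {\<one>})" for u v
    by simp
  have le: "card A \<le> p\<^sup>2 * (2 * q - 1)" if "independent_set ?B A" for A
  proof -
    have "A \<subseteq> pverts (bicay G ?S\<^sub>1 ?S\<^sub>2 {\<one>})"
      and arcs: "\<And>u v. \<lbrakk>u \<in> A; v \<in> A; u \<noteq> v\<rbrakk> \<Longrightarrow> (u, v) \<notin> parcs (bicay G ?S\<^sub>1 ?S\<^sub>2 {\<one>})"
      using that unfolding independent_set_def arc with_proj_simps by blast+
    then have verts: "A \<subseteq> {0, 1} \<times> carrier G"
      by (simp add: bicay_def)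
    define L where "L = (\<lambda>i a. {b. b < q\<^sup>2 \<and> (i, \<phi> (a, b)) \<in> A})"
    have fin: "finite (L i a)" for i a
      by (simp add: L_def)
    \<comment> \<open>Each kind of arc inside a row gives one condition of \<open>row_bound\<close>:
      arcs between the layers give disjointness, quotients of order \<open>q\<close> in layer 0
      injectivity, quotients of order \<open>q\<^sup>2\<close> in layer 1 the single class.\<close>
    have row: "card (L 0 a) + card (L 1 a) \<le> 2 * q - 1" if "a < p\<^sup>2" for a
    proof (rule row_bound[OF _ _ _ \<open>0 < q\<close>])
      show "L 0 a \<inter> L 1 a = {}"
      proof (rule ccontr)
        assume "L 0 a \<inter> L 1 a \<noteq> {}"
        then obtain b where b: "b < q\<^sup>2" "(0, \<phi> (a, b)) \<in> A" "(1, \<phi> (a, b)) \<in> A"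
          by (auto simp: L_def)
        with arcs[of "(0, \<phi> (a, b))" "(1, \<phi> (a, b))"] coord[of 0 1 a b a b] \<open>a < p\<^sup>2\<close>
        show False
          by simp
      qed
      show "inj_on (\<lambda>b. b mod q) (L 0 a)"
      proof (rule inj_onI, rule ccontr)
        fix b b' assume b: "b \<in> L 0 a" "b' \<in> L 0 a" "b mod q = b' mod q" "b \<noteq> b'"
        then have "b < q\<^sup>2" "b' < q\<^sup>2" "(0, \<phi> (a, b)) \<in> A" "(0, \<phi> (a, b')) \<in> A"
          by (simp_all add: L_def)
        with arcs[of "(0, \<phi> (a, b))" "(0, \<phi> (a, b'))"] coord[of 0 0 a b a b']
          inj[of a b a b'] b(3,4) \<open>a < p\<^sup>2\<close>
        show False
          by simp
      qed
      show "b mod q = b' mod q" if b: "b \<in> L 1 a" "b' \<in> L 1 a" for b b'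
      proof (rule ccontr)
        assume mod: "b mod q \<noteq> b' mod q"
        from b have "b < q\<^sup>2" "b' < q\<^sup>2" "(1, \<phi> (a, b)) \<in> A" "(1, \<phi> (a, b')) \<in> A"
          by (simp_all add: L_def)
        moreover have "b \<noteq> b'"
          using mod by blast
        ultimately show False
          using arcs[of "(1, \<phi> (a, b))" "(1, \<phi> (a, b'))"] coord[of 1 1 a b a b']
            inj[of a b a b'] mod \<open>a < p\<^sup>2\<close>
          by simp
      qed
    qed (auto simp: L_def)
    \<comment> \<open>The row index comes first, so that the cardinality of the dependent product is
      a sum over rows.\<close>
    let ?\<psi> = "\<lambda>(a, i, b). (i, \<phi> (a, b))"
    have "A \<subseteq> ?\<psi> ` (SIGMA a:{..<p\<^sup>2}. SIGMA i:{0, 1}. L i a)"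
    proof
      fix u assume "u \<in> A"
      moreover from this verts have "u \<in> {0, 1} \<times> \<phi> ` ({..<p\<^sup>2} \<times> {..<q\<^sup>2})"
        unfolding bij_betw_imp_surj_on[OF \<phi>] by blast
      then obtain i a b where "u = (i, \<phi> (a, b))" "i \<in> {0, 1}" "a < p\<^sup>2" "b < q\<^sup>2"
        by blast
      ultimately show "u \<in> ?\<psi> ` (SIGMA a:{..<p\<^sup>2}. SIGMA i:{0, 1}. L i a)"
        by (intro rev_image_eqI[where x = "(a, i, b)"]) (simp_all add: L_def)
    qed
    then have "card A \<le> card (SIGMA a:{..<p\<^sup>2}. SIGMA i:{0::nat, 1}. L i a)"
      using fin by (intro surj_card_le) auto
    also have "\<dots> = (\<Sum>a<p\<^sup>2. card (L 0 a) + card (L 1 a))"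
      using fin by (simp add: card_SigmaI)
    also have "\<dots> \<le> (\<Sum>a<p\<^sup>2. 2 * q - 1)"
      using row by (intro sum_mono) simp
    finally show ?thesis
      by simp
  qed
  have attained: "\<exists>A. independent_set ?B A \<and> card A = p\<^sup>2 * (2 * q - 1)"
  proof -
    define L where "L = (\<lambda>i a. {b. b < q\<^sup>2 \<and>
      (if i = (0::nat) then b mod q \<noteq> a mod p \<and> b div q = a div p else b mod q = a mod p)})"
    define A where "A = (\<lambda>(a, i, b). (i, \<phi> (a, b))) ` (SIGMA a:{..<p\<^sup>2}. SIGMA i:{0::nat, 1}. L i a)"
    have row: "card (L 0 a) + card (L 1 a) = 2 * q - 1" if "a < p\<^sup>2" for a
      using row_attained[OF assms(3) that] \<open>0 < q\<close> by (simp add: L_def)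
    have "card A = card (SIGMA a:{..<p\<^sup>2}. SIGMA i:{0::nat, 1}. L i a)"
      unfolding A_def by (rule card_image) (auto simp: inj_on_def L_def inj)
    also have "\<dots> = (\<Sum>a<p\<^sup>2. card (L 0 a) + card (L 1 a))"
      by (simp add: card_SigmaI L_def)
    also have "\<dots> = p\<^sup>2 * (2 * q - 1)"
      using row by simp
    finally have "card A = p\<^sup>2 * (2 * q - 1)" .
    moreover have "independent_set ?B A"
      unfolding independent_set_def arc
    proof (intro conjI ballI impI notI)
      show "A \<subseteq> verts ?B"
        using closed by (auto simp: A_def L_def bicay_def)
      have point: "\<exists>i a b. w = (i, \<phi> (a, b)) \<and> i \<in> {0, 1} \<and> a < p\<^sup>2 \<and> b < q\<^sup>2 \<and> b \<in> L i a"
        if w: "w \<in> A" for w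
      proof -
        from w obtain t where t: "t \<in> (SIGMA a:{..<p\<^sup>2}. SIGMA i:{0, 1}. L i a)"
          "w = (case t of (a, i, b) \<Rightarrow> (i, \<phi> (a, b)))"
          unfolding A_def by blast
        obtain a i b where "t = (a, i, b)"
          by (cases t)
        with t show ?thesis
          by (intro exI[of _ i] exI[of _ a] exI[of _ b]) (simp add: L_def)
      qed
      fix u v assume u_in: "u \<in> A" and v_in: "v \<in> A" and "u \<noteq> v"
        and uv: "(u, v) \<in> parcs (bicay G ?S\<^sub>1 ?S\<^sub>2 {\<one>})"
      obtain i a b where u: "u = (i, \<phi> (a, b))" "i \<in> {0, 1}" "a < p\<^sup>2" "b < q\<^sup>2" "b \<in> L i a"
        using point[OF u_in] by blast
      obtain j a' b' where v: "v = (j, \<phi> (a', b'))" "j \<in> {0, 1}" "a' < p\<^sup>2" "b' < q\<^sup>2" "b' \<in> L j a'"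
        using point[OF v_in] by blast
      \<comment> \<open>An arc in layer 0 fixes one coordinate and the residue of the other; as
        \<open>a div p = b div q\<close> on layer 0, the quotients agree too and the points
        coincide. Arcs in layer 1 or between the layers contradict the residue condition in
        \<open>L\<close>.\<close>
      show False
        using coord[OF u(2) v(2) u(3,4) v(3,4), THEN iffD1, OF uv[unfolded u(1) v(1)]]
      proof (elim disjE conjE, goal_cases)
        case 1
        then show False
          using u(5) v(5) div_mult_mod_eq[of a p] div_mult_mod_eq[of a' p] by (simp add: L_def)
      next
        case 2
        then show False
          using u(5) v(5) div_mult_mod_eq[of b q] div_mult_mod_eq[of b' q] by (simp add: L_def)
      qed (use u(2,5) v(2,5) in \<open>auto simp: L_def\<close>)
    qed
    ultimately show ?thesis
      by blast
  qed
  show ?thesis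
    unfolding independence_number_def
  proof (rule Max_eqI)
    show "finite {card A |A. independent_set ?B A}"
      using le by (intro finite_subset[OF _ finite_atMost[of "p\<^sup>2 * (2 * q - 1)"]]) blast
    show "p\<^sup>2 * (2 * q - 1) \<in> {card A |A. independent_set ?B A}"
      using attained by force
  qed (use le in blast)
qed

theorem theorem2p41:
  fixes G :: "('a, 'b) monoid_scheme" (structure)
    and p q :: nat
    and S\<^sub>1 S\<^sub>2 S\<^sub>3 :: "'a set"
  assumes "prime p" and "prime q" and "p \<noteq> q"
    and "group G" and "cyclic_group G" and "order G = p\<^sup>2 * q\<^sup>2"
    and "S\<^sub>1 = {x \<in> carrier G. group.ord G x = p \<or> group.ord G x = q}"
    and "S\<^sub>2 = {x \<in> carrier G. group.ord G x = p\<^sup>2 \<or> group.ord G x = q\<^sup>2}"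
    and "S\<^sub>3 = {\<one>}"
  shows "int (independence_number (with_proj (bicay G S\<^sub>1 S\<^sub>2 S\<^sub>3))) =
    2 * int p * int q * min (int p) (int q) - min ((int p)\<^sup>2) ((int q)\<^sup>2)"
proof -
  \<comment> \<open>With \<open>r < s\<close> the minima are \<open>r\<close> and its square, and
    \<open>0 < s\<close> makes the natural subtraction in \<open>2 * s - 1\<close> exact.\<close>
  have value_less: "int (r\<^sup>2 * (2 * s - 1)) =
      2 * int r * int s * min (int r) (int s) - min ((int r)\<^sup>2) ((int s)\<^sup>2)" if "r < s" for r s :: nat
  proof -
    have "min ((int r)\<^sup>2) ((int s)\<^sup>2) = (int r)\<^sup>2"
      using that by (simp add: min_def power_mono)
    then show ?thesis
      using that by (simp add: of_nat_diff power2_eq_square algebra_simps)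
  qed
  consider "p < q" | "q < p"
    using assms(3) by linarith
  then show ?thesis
  proof cases
    case 1
    then show ?thesis
      using group.independence_number_bicay_less[OF assms(4,1,2) 1 assms(5,6)] value_less[OF 1]
        assms(7-9) by simp
  next
    \<comment> \<open>The group order and the connection sets are symmetric in \<open>p\<close> and
      \<open>q\<close>, so the roles can be exchanged.\<close>
    case 2
    have "order G = q\<^sup>2 * p\<^sup>2"
      using assms(6) by (simp add: mult.commute)
    then show ?thesis
      using group.independence_number_bicay_less[OF assms(4,2,1) 2 assms(5)] value_less[OF 2]
        assms(7-9) by (simp add: disj_commute min.commute mult.commute mult.left_commute)
  qed
qed

end
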